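(* Suppose $\alpha\in(-1,1)\setminus\{0\}$. Let $\kappa,\varphi,\gamma\ge 0$ and $c>0$ with $\kappa\varphi=0$, and $\gamma>0$ if $\alpha<0$. Consider the tempered stable convolution (TSC) process (without Gaussian component), i.e. the spectrally negative Lévy process with Laplace exponent $$\psi(\theta)=(\theta-\varphi)\left[\kappa+c\Gamma(-\alpha)\left(\gamma^\alpha-(\gamma+\theta)^\alpha\right)\right],$$ and let $W$ be its scale function. Then, for $x\ge 0$: if $0<\alpha<1$, $$W(x)=-\frac{e^{\varphi x}}{c\Gamma(-\alpha)}\int_0^x e^{-(\gamma+\varphi)y}\,y^{\alpha-1}\,E_{\alpha,\alpha}\left(\frac{(\kappa+c\Gamma(-\alpha)\gamma^\alpha)\,y^\alpha}{c\Gamma(-\alpha)}\right)dy;$$ if $-1<\alpha<0$, $$W(x)=\frac{e^{\varphi x}}{\kappa+c\Gamma(-\alpha)\gamma^\alpha}+\frac{c\Gamma(-\alpha)e^{\varphi x}}{(\kappa+c\Gamma(-\alpha)\gamma^\alpha)^2}\int_0^x e^{-(\gamma+\varphi)y}\,y^{-\alpha-1}\,E_{-\alpha,-\alpha}\left(\frac{c\Gamma(-\alpha)\,y^{-\alpha}}{\kappa+c\Gamma(-\alpha)\gamma^\alpha}\right)dy.$$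
   Context: A spectrally negative Lévy process $X$ is a real-valued Lévy process with no positive jumps which is not the negative of a subordinator; its Laplace exponent is $\psi(\theta)=\log\mathbb{E}[e^{\theta X_1}]$, $\Re(\theta)\ge 0$, and $\Phi(0)=\sup\{\theta\ge 0:\psi(\theta)=0\}$. The scale function $W=W^{(0)}:\mathbb{R}\to[0,\infty)$ is zero on $(-\infty,0)$, continuous on $[0,\infty)$ (right continuous at the origin), and determined by $\int_0^\infty e^{-\theta x}W(x)\,dx=1/\psi(\theta)$ for $\Re(\theta)>\Phi(0)$. $\Gamma$ is the gamma function as a meromorphic function, so $\Gamma(-\alpha)=-\alpha^{-1}\Gamma(1-\alpha)$, which is negative for $\alpha\in(0,1)$. The function $\psi$ in the claim is known to be the Laplace exponent of a spectrally negative Lévy process. $E_{a,b}(z)=\sum_{k\ge 0}\frac{z^k}{\Gamma(ak+b)}$ is the two-parameter Mittag-Leffler function ($a,b>0$). *)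

theory Defs
  imports "HOL-Probability.Probability"
begin

text \<open>Processes are indexed by all of \<^typ>\<open>real\<close>, but only times \<open>t \<ge> 0\<close> matter.\<close>

locale levy_process = prob_space M for M :: "'a measure" +
  fixes X :: "real \<Rightarrow> 'a \<Rightarrow> real"
  assumes random_variable_X: "t \<ge> 0 \<Longrightarrow> random_variable borel (X t)"
    and start_zero: "AE \<omega> in M. X 0 \<omega> = 0"
    and indep_increments:
      "\<And>(n::nat) (t::nat \<Rightarrow> real). 0 \<le> t 0 \<Longrightarrow> (\<And>i. i < n \<Longrightarrow> t i < t (Suc i)) \<Longrightarrow>
        indep_vars (\<lambda>_. borel) (\<lambda>i \<omega>. X (t (Suc i)) \<omega> - X (t i) \<omega>) {..<n}"
    and stationary_increments:
      "0 \<le> s \<Longrightarrow> 0 \<le> h \<Longrightarrow>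
        distr M borel (\<lambda>\<omega>. X (s + h) \<omega> - X s \<omega>) = distr M borel (X h)"
    and cadlag:
      "AE \<omega> in M. (\<forall>t\<ge>0. continuous (at_right t) (\<lambda>s. X s \<omega>)) \<and>
                  (\<forall>t>0. \<exists>l. ((\<lambda>s. X s \<omega>) \<longlongrightarrow> l) (at_left t))"

locale subordinator = levy_process +
  assumes nondecreasing_paths: "AE \<omega> in M. mono_on {0..} (\<lambda>t. X t \<omega>)"

locale spectrally_negative_levy_process = levy_process +
  assumes no_positive_jumps:
      "AE \<omega> in M. \<forall>t>0. \<forall>l. ((\<lambda>s. X s \<omega>) \<longlongrightarrow> l) (at_left t) \<longrightarrow> X t \<omega> \<le> l"
    and not_negative_subordinator: "\<not> subordinator M (\<lambda>t \<omega>. - X t \<omega>)"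

text \<open>
  For complex \<open>\<theta>\<close> the logarithm in \<open>\<psi>(\<theta>) = log E[exp(\<theta> X\<^sub>1)]\<close> is the continuous branch on the
  closed right half-plane that vanishes at \<open>0\<close>; the principal branch \<^const>\<open>Ln\<close> would in general
  be discontinuous. These conditions determine \<open>\<psi>\<close> uniquely on that half-plane, and
  on \<open>[0, \<infinity>)\<close> they amount to the real logarithm.
\<close>

definition is_laplace_exponent ::
    "'a measure \<Rightarrow> (real \<Rightarrow> 'a \<Rightarrow> real) \<Rightarrow> (complex \<Rightarrow> complex) \<Rightarrow> bool" where
  "is_laplace_exponent M X \<psi> \<longleftrightarrow>
     continuous_on {\<theta>. Re \<theta> \<ge> 0} \<psi> \<and> \<psi> 0 = 0 \<and>
     (\<forall>\<theta>. Re \<theta> \<ge> 0 \<longrightarrow>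
        integrable M (\<lambda>\<omega>. exp (\<theta> * complex_of_real (X 1 \<omega>))) \<and>
        exp (\<psi> \<theta>) = (LINT \<omega>|M. exp (\<theta> * complex_of_real (X 1 \<omega>))))"

definition Phi_zero :: "(complex \<Rightarrow> complex) \<Rightarrow> real" where
  "Phi_zero \<psi> = Sup {\<theta>::real. \<theta> \<ge> 0 \<and> \<psi> (complex_of_real \<theta>) = 0}"

definition is_scale_function :: "(complex \<Rightarrow> complex) \<Rightarrow> (real \<Rightarrow> real) \<Rightarrow> bool" where
  "is_scale_function \<psi> W \<longleftrightarrow>
     (\<forall>x. W x \<ge> 0) \<and> (\<forall>x<0. W x = 0) \<and> continuous_on {0..} W \<and>
     (\<forall>\<theta>. Re \<theta> > Phi_zero \<psi> \<longrightarrow>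
        set_integrable lborel {0..} (\<lambda>x. exp (- \<theta> * complex_of_real x) * complex_of_real (W x)) \<and>
        (LINT x:{0..}|lborel. exp (- \<theta> * complex_of_real x) * complex_of_real (W x)) = 1 / \<psi> \<theta>)"

definition mittag_leffler :: "real \<Rightarrow> real \<Rightarrow> 'a::{real_normed_field,banach} \<Rightarrow> 'a" where
  "mittag_leffler a b z = (\<Sum>k. z ^ k / of_real (Gamma (a * real k + b)))"

text \<open>
  The complex power is the principal one. Its base \<open>\<gamma> + \<theta>\<close> has nonnegative real part where
  this is used, and it vanishes only for \<open>\<gamma> = \<theta> = 0\<close>, where the library's \<open>0 powr \<alpha> = 0\<close> is the
  right value for \<open>\<alpha> > 0\<close>; for \<open>\<alpha> < 0\<close> one assumes \<open>\<gamma> > 0\<close>.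
\<close>

definition tsc_exponent ::
    "real \<Rightarrow> real \<Rightarrow> real \<Rightarrow> real \<Rightarrow> real \<Rightarrow> complex \<Rightarrow> complex" where
  "tsc_exponent \<alpha> \<kappa> \<phi> \<gamma> c \<theta> =
     (\<theta> - complex_of_real \<phi>) *
     (complex_of_real \<kappa> + complex_of_real (c * Gamma (- \<alpha>)) *
        (complex_of_real (\<gamma> powr \<alpha>) - (complex_of_real \<gamma> + \<theta>) powr complex_of_real \<alpha>))"

end

theory Submission
  imports Defs
begin

text \<open>
  A scale function is determined by its Laplace transform, so it suffices to check that the claimed
  formula has the right transform; real arguments are enough for this. Put \<open>B = c \<Gamma>(-\<alpha>)\<close> and
  \<open>K = \<kappa> + B \<gamma>\<^sup>\<alpha>\<close>, so that \<open>\<psi>(s) = (s - \<phi>) (K - B (s + \<gamma>)\<^sup>\<alpha>)\<close>. For \<open>s > \<phi>\<close> both factors are positive,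
  since \<open>B\<close> and \<open>\<alpha>\<close> have opposite signs; hence \<open>\<Phi>(0) \<le> \<phi>\<close>, and \<open>1 / \<psi>(s)\<close> is the transform of \<open>W\<close>
  for all \<open>s > \<phi>\<close>.

  With \<open>a = \<bar>\<alpha>\<bar>\<close>, the second factor satisfies
  \<open>1 / (K - B (s + \<gamma>)\<^sup>\<alpha>) = C + D / ((s + \<gamma>)\<^sup>a - \<mu>)\<close>, where \<open>C = 0\<close>, \<open>D = - 1 / B\<close>, \<open>\<mu> = K / B\<close> if \<open>\<alpha> > 0\<close>,
  and \<open>C = 1 / K\<close>, \<open>D = B / K\<^sup>2\<close>, \<open>\<mu> = B / K\<close> if \<open>\<alpha> < 0\<close>. This right-hand side can be inverted piece by
  piece: expanding \<open>E\<^bsub>a,a\<^esub>\<close> into its series and integrating each power against the exponential gives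
  a geometric series, so that \<open>y\<^bsup>a-1\<^esup> E\<^bsub>a,a\<^esub>(\<mu> y\<^sup>a)\<close> has transform \<open>1 / (s\<^sup>a - \<mu>)\<close> as soon as \<open>s\<^sup>a > \<bar>\<mu>\<bar>\<close>
  (\<open>has_laplace_transform_mittag_leffler\<close>). The shift by \<open>\<gamma>\<close> becomes an exponential factor, and
  division by \<open>s - \<phi>\<close> becomes integration over \<open>{0..x}\<close> followed by multiplication with \<open>exp (\<phi> x)\<close>
  (\<open>has_laplace_transform_indefinite_integral\<close>). The transforms of \<open>W\<close> and of the formula thus agree
  for all large \<open>s\<close>, and both functions are continuous on \<open>{0..}\<close>, so they coincide
  (\<open>laplace_transform_unique\<close>).
\<close>

section \<open>Laplace transforms on the half-line\<close>

definition has_laplace_transform :: "(real \<Rightarrow> real) \<Rightarrow> real \<Rightarrow> real \<Rightarrow> bool" where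
  "has_laplace_transform f s L \<longleftrightarrow>
     has_bochner_integral lborel (\<lambda>x. indicator {0..} x * (exp (- s * x) * f x)) L"

lemma has_bochner_integral_exp_tail:
  fixes s y :: real
  assumes "s > 0"
  shows "has_bochner_integral lborel (\<lambda>x. indicator {y..} x * exp (- s * x)) (exp (- s * y) / s)"
  using nn_integral_has_integral_lebesgue[OF _ has_integral_exp_minus_to_infinity[OF assms, of y]] assms
  by (intro has_bochner_integral_nn_integral) auto

lemma has_laplace_transform_add:
  "has_laplace_transform f s K \<Longrightarrow> has_laplace_transform g s L \<Longrightarrow>
     has_laplace_transform (\<lambda>x. f x + g x) s (K + L)"
  unfolding has_laplace_transform_def
  by (drule (1) has_bochner_integral_add) (simp add: algebra_simps)

lemma has_laplace_transform_cmult: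
  "has_laplace_transform f s L \<Longrightarrow> has_laplace_transform (\<lambda>x. c * f x) s (c * L)"
  using has_bochner_integral_mult_right[where c = c and M = lborel and x = L and
      f = "\<lambda>x. indicator {0..} x * (exp (- s * x) * f x)"]
  by (simp add: has_laplace_transform_def mult.left_commute[of c])

lemma has_laplace_transform_const:
  "s > 0 \<Longrightarrow> has_laplace_transform (\<lambda>x. c) s (c / s)"
  using has_laplace_transform_cmult[of "\<lambda>_. 1" s "1 / s" c] has_bochner_integral_exp_tail[of s 0]
  by (simp add: has_laplace_transform_def)

lemma has_laplace_transform_exp_mult:
  assumes "has_laplace_transform f (s - a) L"
  shows "has_laplace_transform (\<lambda>x. exp (a * x) * f x) s L"
proof -
  have "exp (- s * x) * (exp (a * x) * f x) = exp (- (s - a) * x) * f x" for x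
    by (simp add: exp_add [symmetric] algebra_simps flip: mult.assoc)
  then show ?thesis
    using assms by (simp only: has_laplace_transform_def)
qed

text \<open>
  The substitution \<open>t = s y\<close> reduces this to Euler's integral for \<open>\<Gamma>(p)\<close>.
\<close>

lemma has_laplace_transform_powr:
  assumes "p > 0" and "s > 0"
  shows "has_laplace_transform (\<lambda>y. y powr (p - 1)) s (Gamma p / s powr p)"
proof -
  have "ennreal (Gamma p) = (\<integral>\<^sup>+ t. ennreal (indicator {0..} t * t powr (p - 1) / exp t) \<partial>lborel)"
    using assms by (simp add: Gamma_conv_nn_integral_real)
  then have "has_bochner_integral lborel
      (\<lambda>t. indicator {0..} t * t powr (p - 1) / exp t) (Gamma p)"
    using assms by (intro has_bochner_integral_nn_integral) (auto intro: less_imp_le Gamma_real_pos)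
  then have "has_bochner_integral lborel
      (\<lambda>y. indicator {0..} (0 + s * y) * (0 + s * y) powr (p - 1) / exp (0 + s * y)) (Gamma p /\<^sub>R \<bar>s\<bar>)"
    using assms by (subst (asm) lborel_has_bochner_integral_real_affine_iff[where c=s and t=0]) simp_all
  then have "has_bochner_integral lborel
      (\<lambda>y. inverse (s powr (p - 1)) *
        (indicator {0..} (0 + s * y) * (0 + s * y) powr (p - 1) / exp (0 + s * y)))
      (inverse (s powr (p - 1)) * (Gamma p /\<^sub>R \<bar>s\<bar>))"
    by (rule has_bochner_integral_mult_right)
  also have "(\<lambda>y. inverse (s powr (p - 1)) *
        (indicator {0..} (0 + s * y) * (0 + s * y) powr (p - 1) / exp (0 + s * y))) =
      (\<lambda>y. indicator {0..} y * (exp (- s * y) * y powr (p - 1)))"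
    using assms by (auto simp: fun_eq_iff indicator_def zero_le_mult_iff powr_mult exp_minus field_simps)
  also have "inverse (s powr (p - 1)) * (Gamma p /\<^sub>R \<bar>s\<bar>) = Gamma p / s powr p"
    using assms by (simp add: powr_diff field_simps)
  finally show ?thesis
    by (simp add: has_laplace_transform_def)
qed

text \<open>
  By monotone convergence the sum of the norms has a finite integral, so it is finite almost
  everywhere. For the Mittag-Leffler series this derives pointwise convergence from the known integrals of
  the terms.
\<close>

lemma AE_summable_if_summable_integral_norm:
  fixes f :: "nat \<Rightarrow> 'a \<Rightarrow> real"
  assumes int: "\<And>k. integrable M (f k)"
    and summ: "summable (\<lambda>k. \<integral>x. norm (f k x) \<partial>M)"
  shows "AE x in M. summable (\<lambda>k. norm (f k x))"
proof -
  have [measurable]: "f k \<in> borel_measurable M" for k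
    using int by auto
  have "(\<integral>\<^sup>+x. (\<Sum>k. ennreal (norm (f k x))) \<partial>M) = (\<Sum>k. \<integral>\<^sup>+x. ennreal (norm (f k x)) \<partial>M)"
    by (intro nn_integral_suminf) auto
  also have "\<dots> = (\<Sum>k. ennreal (\<integral>x. norm (f k x) \<partial>M))"
    using int by (simp add: nn_integral_eq_integral)
  also have "\<dots> = ennreal (\<Sum>k. \<integral>x. norm (f k x) \<partial>M)"
    using summ by (intro suminf_ennreal2) auto
  finally have "AE x in M. (\<Sum>k. ennreal (norm (f k x))) \<noteq> \<infinity>"
    by (intro nn_integral_PInf_AE) auto
  then show ?thesis
    by eventually_elim (rule summable_suminf_not_top, auto)
qed

text \<open>
  The factor \<open>\<Gamma>(a k + a)\<close> in the transform of \<open>y\<^bsup>ak+a-1\<^esup>\<close> cancels the denominator of the \<open>k\<close>-th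
  coefficient, which leaves \<open>\<mu>\<^sup>k / s\<^bsup>a(k+1)\<^esup>\<close>. The bound on \<open>\<mu>\<close> is what makes this geometric series
  converge absolutely, and absolute convergence justifies the termwise integration.
\<close>

lemma has_laplace_transform_mittag_leffler:
  assumes a: "a > 0" and s: "s > 0" and large: "\<bar>\<mu>\<bar> < s powr a"
  shows "has_laplace_transform (\<lambda>y. y powr (a - 1) * mittag_leffler a a (\<mu> * y powr a)) s
           (1 / (s powr a - \<mu>))"
proof -
  define c where "c k = \<mu> ^ k / Gamma (a * real k + a)" for k :: nat
  define f where "f k y = indicator {0..} y * (exp (- s * y) * (y powr ((a * real k + a) - 1)))"
    for k :: nat and y :: real
  have pos: "a * real k + a > 0" for k
    using a by (simp add: add_nonneg_pos)
  have G: "Gamma (a * real k + a) > 0" for k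
    using pos by (rule Gamma_real_pos)
  have f: "has_bochner_integral lborel (f k) (Gamma (a * real k + a) / s powr (a * real k + a))" for k
    using has_laplace_transform_powr[OF pos s] by (simp add: f_def[abs_def] has_laplace_transform_def)
  have cf: "has_bochner_integral lborel (\<lambda>y. c k * f k y) (\<mu> ^ k / s powr (a * real k + a))" for k
    using has_bochner_integral_mult_right[OF f[of k], of "c k"] G[of k] by (simp add: c_def)
  have power: "s powr (a * real k + a) = s powr a * (s powr a) ^ k" for k
    using s by (simp add: powr_add powr_powr flip: powr_realpow)
  have norm_int: "(\<integral>y. norm (c k * f k y) \<partial>lborel) = (\<bar>\<mu>\<bar> / s powr a) ^ k / s powr a" for k
  proof -
    have "(\<integral>y. norm (c k * f k y) \<partial>lborel) = (\<integral>y. \<bar>c k\<bar> * f k y \<partial>lborel)"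
      by (simp add: abs_mult f_def)
    also have "\<dots> = \<bar>c k\<bar> * (Gamma (a * real k + a) / s powr (a * real k + a))"
      using f[of k] by (simp add: has_bochner_integral_iff)
    also have "\<dots> = (\<bar>\<mu>\<bar> / s powr a) ^ k / s powr a"
      using G[of k] by (simp add: c_def abs_mult power power_divide power_abs)
    finally show ?thesis .
  qed
  have nz: "s powr a \<noteq> 0" "s powr a - \<mu> \<noteq> 0"
    using large s by auto
  have ratio: "\<bar>\<mu> / s powr a\<bar> < 1" "\<bar>\<bar>\<mu>\<bar> / s powr a\<bar> < 1"
    using large s by auto
  have int: "integrable lborel (\<lambda>y. c k * f k y)" for k
    using cf by (simp add: has_bochner_integral_iff)
  have summ: "summable (\<lambda>k. \<integral>y. norm (c k * f k y) \<partial>lborel)"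
    unfolding norm_int using ratio(2) by (intro summable_divide summable_geometric) simp
  note ae = AE_summable_if_summable_integral_norm[OF int summ]
  have "(\<lambda>k. \<integral>y. c k * f k y \<partial>lborel) sums (\<integral>y. (\<Sum>k. c k * f k y) \<partial>lborel)"
    using int ae summ by (rule sums_integral)
  moreover have "(\<lambda>k. \<integral>y. c k * f k y \<partial>lborel) sums (1 / (s powr a - \<mu>))"
  proof -
    have "(\<lambda>k. (\<mu> / s powr a) ^ k / s powr a) sums (1 / (1 - \<mu> / s powr a) / s powr a)"
      using ratio(1) by (intro sums_divide geometric_sums) simp
    also have "1 / (1 - \<mu> / s powr a) / s powr a = 1 / (s powr a - \<mu>)"
      using nz by (simp add: field_simps)
    finally show ?thesis
      using cf by (simp add: has_bochner_integral_iff power power_divide mult.commute)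
  qed
  ultimately have val: "(\<integral>y. (\<Sum>k. c k * f k y) \<partial>lborel) = 1 / (s powr a - \<mu>)"
    by (rule sums_unique2)
  have hbi: "has_bochner_integral lborel (\<lambda>y. \<Sum>k. c k * f k y) (1 / (s powr a - \<mu>))"
    using integrable_suminf[OF int ae summ] val by (simp add: has_bochner_integral_iff)
  have term_eq: "c k * f k y = exp (- s * y) * y powr (a - 1) *
      ((\<mu> * y powr a) ^ k / Gamma (a * real k + a))" if "y > 0" for k y
  proof -
    have "y powr (a * real k + a - 1) = y powr (a - 1) * (y powr a) ^ k"
      using that by (simp add: powr_powr algebra_simps flip: powr_realpow powr_add)
    then show ?thesis
      using that by (simp add: c_def f_def power_mult_distrib)
  qed
  have "AE y in lborel. (\<Sum>k. c k * f k y) =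
      indicator {0..} y * (exp (- s * y) * (y powr (a - 1) * mittag_leffler a a (\<mu> * y powr a)))"
    using ae
  proof eventually_elim
    fix y :: real
    assume summ_y: "summable (\<lambda>k. norm (c k * f k y))"
    show "(\<Sum>k. c k * f k y) =
      indicator {0..} y * (exp (- s * y) * (y powr (a - 1) * mittag_leffler a a (\<mu> * y powr a)))"
    proof (cases "y > 0")
      case True
      have "summable (\<lambda>k. c k * f k y)"
        using summ_y by (rule summable_norm_cancel)
      then have "summable (\<lambda>k. exp (- s * y) * y powr (a - 1) * ((\<mu> * y powr a) ^ k / Gamma (a * real k + a)))"
        unfolding term_eq[OF True] .
      then have "summable (\<lambda>k. (\<mu> * y powr a) ^ k / Gamma (a * real k + a))"
        by (rule summable_mult_D) (use True in simp)
      then show ?thesis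
        using True unfolding term_eq[OF True]
        by (subst suminf_mult) (simp_all add: mittag_leffler_def)
    qed (auto simp: f_def indicator_def)
  qed
  then show ?thesis
    using hbi unfolding has_laplace_transform_def
    by (subst has_bochner_integral_cong_AE[where f = "\<lambda>y. indicator {0..} y * _ y" and g = "\<lambda>y. \<Sum>k. c k * f k y"])
       (auto simp: mittag_leffler_def f_def eq_commute)
qed

text \<open>
  Exchange the integrals over \<open>0 \<le> y \<le> x\<close>: for fixed \<open>y\<close>, the kernel \<open>exp (- s x)\<close> integrates over
  \<open>{y..}\<close> to \<open>exp (- s y) / s\<close>.
\<close>

lemma has_laplace_transform_indefinite_integral:
  assumes s: "s > 0" and f: "has_laplace_transform f s L"
  shows "has_laplace_transform (\<lambda>x. LINT y:{0..x}|lborel. f y) s (L / s)"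
proof -
  define g where "g y = indicator {0..} y * f y" for y :: real
  define F where "F y x = g y * (indicator {y..} x * exp (- s * x))" for x y :: real
  have int_g: "has_bochner_integral lborel (\<lambda>y. exp (- s * y) * g y) L"
    using f by (simp add: has_laplace_transform_def g_def mult.left_commute)
  have "(\<lambda>y. exp (s * y) * (exp (- s * y) * g y)) \<in> borel_measurable lborel"
    using borel_measurable_has_bochner_integral[OF int_g] by measurable
  then have g [measurable]: "g \<in> borel_measurable borel"
    by (simp flip: mult.assoc exp_add)
  have F: "has_bochner_integral lborel (F y) (exp (- s * y) * g y / s)" for y
    using has_bochner_integral_mult_right[OF has_bochner_integral_exp_tail[OF s, of y], of "g y"]
    by (simp add: F_def[abs_def] mult_ac)
  have norm_F: "(\<integral>x. norm (F y x) \<partial>lborel) = norm (exp (- s * y) * g y) / s" for y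
  proof -
    have "(\<integral>x. norm (F y x) \<partial>lborel) = (\<integral>x. \<bar>g y\<bar> * (indicator {y..} x * exp (- s * x)) \<partial>lborel)"
      by (simp add: F_def abs_mult)
    also have "\<dots> = norm (exp (- s * y) * g y) / s"
      using has_bochner_integral_exp_tail[OF s, of y] by (simp add: has_bochner_integral_iff abs_mult)
    finally show ?thesis .
  qed
  have "(\<lambda>p. g (fst p) * ((if fst p \<le> snd p then 1 else 0) * exp (- s * snd p)))
          \<in> borel_measurable (lborel \<Otimes>\<^sub>M lborel)"
    by measurable
  then have meas: "case_prod F \<in> borel_measurable (lborel \<Otimes>\<^sub>M lborel)"
    by (simp add: F_def indicator_def case_prod_unfold of_bool_def cong: if_cong)
  have int_F: "integrable (lborel \<Otimes>\<^sub>M lborel) (case_prod F)"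
  proof (rule lborel_pair.Fubini_integrable[OF meas])
    show "integrable lborel (\<lambda>y. \<integral>x. norm (case_prod F (y, x)) \<partial>lborel)"
      unfolding case_prod_conv norm_F using int_g
      by (intro integrable_divide_zero integrable_norm) (simp add: has_bochner_integral_iff)
    show "AE y in lborel. integrable lborel (\<lambda>x. case_prod F (y, x))"
      using F by (simp add: has_bochner_integral_iff)
  qed
  have inner: "(\<integral>y. F y x \<partial>lborel) =
      indicator {0..} x * (exp (- s * x) * (LINT y:{0..x}|lborel. f y))" for x
  proof -
    have "(\<integral>y. F y x \<partial>lborel) = (\<integral>y. exp (- s * x) * (indicator {0..x} y * f y) \<partial>lborel)"
      by (intro Bochner_Integration.integral_cong) (auto simp: F_def g_def indicator_def)
    then show ?thesis
      by (cases "0 \<le> x") (simp_all add: set_lebesgue_integral_def)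
  qed
  have "(\<integral>x. (\<integral>y. F y x \<partial>lborel) \<partial>lborel) = (\<integral>y. (\<integral>x. F y x \<partial>lborel) \<partial>lborel)"
    using int_F by (rule lborel_pair.Fubini_integral)
  also have "\<dots> = L / s"
    using F int_g by (simp add: has_bochner_integral_iff)
  finally show ?thesis
    using lborel_pair.integrable_snd[OF int_F]
    by (simp add: has_laplace_transform_def has_bochner_integral_iff inner)
qed

text \<open>
  Any transform, at whatever \<open>s\<close>, makes \<open>f\<close> integrable on bounded intervals, where the exponential
  weight is bounded away from zero.
\<close>

lemma continuous_on_indefinite_integral:
  fixes f :: "real \<Rightarrow> real"
  assumes f: "has_laplace_transform f s L"
  shows "continuous_on {0..} (\<lambda>x. LINT y:{0..x}|lborel. f y)"
proof -
  define I where "I x = (LINT y:{0..x}|lborel. f y)" for x :: real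
  have loc: "set_integrable lborel {0..b} f" for b
  proof -
    have "set_integrable lborel {0..} (\<lambda>y. exp (- s * y) * f y)"
      using f by (simp add: has_laplace_transform_def has_bochner_integral_iff set_integrable_def)
    then have "set_integrable lborel {0..b} (\<lambda>y. exp (- s * y) * f y)"
      by (rule set_integrable_subset) auto
    then have *: "integrable lborel (\<lambda>y. exp (- s * y) * (indicator {0..b} y * f y))"
      by (simp add: set_integrable_def mult_ac)
    have "(\<lambda>y. exp (s * y) * (exp (- s * y) * (indicator {0..b} y * f y))) \<in> borel_measurable lborel"
      using borel_measurable_integrable[OF *] by measurable
    then have [measurable]: "(\<lambda>y. indicator {0..b} y * f y) \<in> borel_measurable lborel"
      by (simp flip: mult.assoc exp_add)
    have "integrable lborel (\<lambda>y. indicator {0..b} y * f y)"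
    proof (rule Bochner_Integration.integrable_bound)
      show "integrable lborel (\<lambda>y. exp (\<bar>s\<bar> * b) * (exp (- s * y) * (indicator {0..b} y * f y)))"
        using * by (rule integrable_mult_right)
      show "AE y in lborel. norm (indicator {0..b} y * f y)
          \<le> norm (exp (\<bar>s\<bar> * b) * (exp (- s * y) * (indicator {0..b} y * f y)))"
      proof (intro AE_I2)
        fix y
        have "1 \<le> exp (\<bar>s\<bar> * b) * exp (- s * y)" if "0 \<le> y" "y \<le> b"
        proof -
          have "s * y \<le> \<bar>s\<bar> * y" "\<bar>s\<bar> * y \<le> \<bar>s\<bar> * b"
            using that by (auto intro: mult_right_mono mult_left_mono)
          then show ?thesis
            by (simp flip: exp_add)
        qed
        then show "norm (indicator {0..b} y * f y)
          \<le> norm (exp (\<bar>s\<bar> * b) * (exp (- s * y) * (indicator {0..b} y * f y)))"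
          by (auto simp: indicator_def abs_mult mult_le_cancel_right1 simp flip: mult.assoc)
      qed
    qed simp
    then show ?thesis
      by (simp add: set_integrable_def)
  qed
  have I: "continuous_on {0..b} I" for b
  proof -
    have "continuous_on {0..b} (\<lambda>x. integral {0..x} f)"
      using set_borel_integral_eq_integral(1)[OF loc] by (rule indefinite_integral_continuous_1)
    then show ?thesis
      by (simp add: I_def[abs_def] set_borel_integral_eq_integral(2)[OF loc])
  qed
  show ?thesis
    unfolding I_def [symmetric] continuous_on_eq_continuous_within
  proof
    fix x :: real
    assume "x \<in> {0..}"
    then have "continuous (at x within {0..x + 1}) I"
      using I[of "x + 1"] by (simp add: continuous_on_eq_continuous_within)
    moreover have "at x within {0..} = at x within {0..x + 1}"
      by (rule at_within_nhd[of x "{..<x + 1}"]) auto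
    ultimately show "continuous (at x within {0..}) I"
      by simp
  qed
qed

section \<open>Uniqueness of the Laplace transform\<close>

text \<open>
  Lerch's theorem for continuous functions. Evaluating the transform at \<open>s0 + n\<close> shows that
  \<open>exp (- s0 y) h(y)\<close> integrates to zero against \<open>exp (- y)\<^sup>n\<close> for every \<open>n\<close>, hence by Weierstrass
  approximation on \<open>{0..1}\<close> against every continuous function of \<open>exp (- y)\<close>. If \<open>h\<close> were nonzero
  at \<open>x\<close>, a bump supported near \<open>x\<close>, where \<open>h\<close> has constant sign, would give a nonzero integral.
\<close>

lemma laplace_transform_zero_imp_zero:
  fixes h :: "real \<Rightarrow> real"
  assumes cont: "continuous_on {0..} h"
    and transform: "\<And>s. s \<ge> s0 \<Longrightarrow> has_laplace_transform h s 0"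
    and "x \<ge> 0"
  shows "h x = 0"
proof (rule ccontr)
  assume "h x \<noteq> 0"
  define G where "G y = indicator {0..} y * (exp (- s0 * y) * h y)" for y :: real
  have G: "integrable lborel G"
    using transform[of s0] by (simp add: G_def[abs_def] has_laplace_transform_def has_bochner_integral_iff)
  have [measurable]: "G \<in> borel_measurable borel"
    using borel_measurable_integrable[OF G] by simp
  have power: "has_bochner_integral lborel (\<lambda>y. exp (- y) ^ n * G y) 0" for n :: nat
  proof -
    have "exp (- y) ^ n * G y = indicator {0..} y * (exp (- (s0 + real n) * y) * h y)" for y
    proof -
      have "exp (- y) ^ n * exp (- s0 * y) = exp (- (s0 + real n) * y)"
        by (simp add: exp_add [symmetric] algebra_simps flip: exp_of_nat_mult)
      then show ?thesis
        by (simp add: G_def flip: mult.assoc)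
    qed
    then show ?thesis
      using transform[of "s0 + real n"] by (simp add: has_laplace_transform_def)
  qed
  have poly: "has_bochner_integral lborel (\<lambda>y. p (exp (- y)) * G y) 0"
    if p: "real_polynomial_function p" for p
  proof -
    obtain a n where p_eq: "p = (\<lambda>u. \<Sum>i\<le>n. a i * u ^ i)"
      using p by (auto simp: real_polynomial_function_iff_sum)
    have "has_bochner_integral lborel (\<lambda>y. \<Sum>i\<le>n. a i * (exp (- y) ^ i * G y)) (\<Sum>i\<le>n. a i * 0)"
      by (intro has_bochner_integral_sum has_bochner_integral_mult_right power)
    then show ?thesis
      by (simp add: p_eq sum_distrib_right mult.assoc)
  qed
  have continuous: "has_bochner_integral lborel (\<lambda>y. q (exp (- y)) * G y) 0"
    if q: "continuous_on UNIV q" for q :: "real \<Rightarrow> real"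
  proof -
    have [measurable]: "q \<in> borel_measurable borel"
      using q by (rule borel_measurable_continuous_onI)
    \<comment> \<open>Replacing \<open>q\<close> by a polynomial that is \<open>e\<close>-close on \<open>{0..1}\<close> changes the
      integral by at most \<open>e\<close> times the \<open>L\<^sup>1\<close> norm of \<open>G\<close>, and for the polynomial
      the integral is zero.\<close>
    have approx: "integrable lborel (\<lambda>y. q (exp (- y)) * G y) \<and>
        \<bar>\<integral>y. q (exp (- y)) * G y \<partial>lborel\<bar> \<le> e * (\<integral>y. \<bar>G y\<bar> \<partial>lborel)" if e: "e > 0" for e
    proof -
      have "continuous_on {0..1} q"
        using q by (rule continuous_on_subset) simp
      then obtain p where p: "real_polynomial_function p"
        and close: "\<And>u. u \<in> {0..1} \<Longrightarrow> \<bar>q u - p u\<bar> < e"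
        using Stone_Weierstrass_real_polynomial_function[OF compact_Icc _ e] by metis
      have [measurable]: "p \<in> borel_measurable borel"
        using p by (intro borel_measurable_continuous_onI continuous_on_polymonial_function)
          (simp add: real_polynomial_function_eq)
      have bound: "norm ((q (exp (- y)) - p (exp (- y))) * G y) \<le> e * \<bar>G y\<bar>" for y
        using close[of "exp (- y)"]
        by (cases "y \<ge> 0") (auto simp: abs_mult G_def intro!: mult_right_mono)
      have int_bound: "integrable lborel (\<lambda>y. e * \<bar>G y\<bar>)"
        using G by simp
      have int: "integrable lborel (\<lambda>y. (q (exp (- y)) - p (exp (- y))) * G y)"
        by (rule Bochner_Integration.integrable_bound[OF int_bound])
          (use bound e in \<open>auto intro!: AE_I2 simp: abs_mult\<close>)
      have split: "q (exp (- y)) * G y = (q (exp (- y)) - p (exp (- y))) * G y + p (exp (- y)) * G y" for y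
        by (simp add: algebra_simps)
      have "\<bar>\<integral>y. (q (exp (- y)) - p (exp (- y))) * G y \<partial>lborel\<bar> \<le> (\<integral>y. e * \<bar>G y\<bar> \<partial>lborel)"
        using Bochner_Integration.integral_norm_bound_integral[OF int int_bound] bound by simp
      then show ?thesis
        unfolding split using int poly[OF p] by (simp add: has_bochner_integral_iff)
    qed
    have "\<bar>\<integral>y. q (exp (- y)) * G y \<partial>lborel\<bar> \<le> 0"
    proof (rule ccontr)
      define I A where "I = \<bar>\<integral>y. q (exp (- y)) * G y \<partial>lborel\<bar>" and "A = (\<integral>y. \<bar>G y\<bar> \<partial>lborel)"
      assume "\<not> \<bar>\<integral>y. q (exp (- y)) * G y \<partial>lborel\<bar> \<le> 0"
      then have "I > 0" by (simp add: I_def)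
      moreover have "A \<ge> 0" by (simp add: A_def)
      ultimately have "I \<le> I / (A + 1) * A"
        using approx[of "I / (A + 1)"] unfolding I_def A_def by (metis add_nonneg_pos divide_pos_pos zero_less_one)
      then show False
        using \<open>I > 0\<close> \<open>A \<ge> 0\<close> by (simp add: field_simps)
    qed
    then show ?thesis
      using approx[of 1] by (simp add: has_bochner_integral_iff)
  qed
  obtain d where d: "d > 0" and near: "\<And>y. y \<ge> 0 \<Longrightarrow> \<bar>y - x\<bar> < d \<Longrightarrow> \<bar>h y - h x\<bar> < \<bar>h x\<bar>"
    using cont \<open>x \<ge> 0\<close> \<open>h x \<noteq> 0\<close> unfolding continuous_on_iff dist_real_def
    by (metis atLeast_iff zero_less_abs_iff)
  have sign: "sgn (h x) * h y > 0" if "y \<ge> 0" "\<bar>y - x\<bar> < d" for y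
    using near[OF that] by (auto simp: sgn_if split: if_splits)
  \<comment> \<open>In terms of \<open>u = exp (- y)\<close>, this bump is positive exactly for \<open>x - d < y < x + d\<close>.\<close>
  define q where "q u = max 0 (u - exp (- (x + d))) * max 0 (exp (- (x - d)) - u)" for u :: real
  have q_pos: "q (exp (- y)) > 0" if "\<bar>y - x\<bar> < d" for y
    using that by (auto simp: q_def intro!: mult_pos_pos)
  have q_zero: "q (exp (- y)) = 0" if "\<not> \<bar>y - x\<bar> < d" for y
  proof -
    have "exp (- y) \<le> exp (- (x + d)) \<or> exp (- (x - d)) \<le> exp (- y)"
      using that by auto
    then show ?thesis
      by (elim disjE) (simp_all only: q_def max_absorb1 diff_le_0_iff_le mult_zero_left mult_zero_right)
  qed
  have int: "has_bochner_integral lborel (\<lambda>y. sgn (h x) * (q (exp (- y)) * G y)) (sgn (h x) * 0)"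
    by (intro has_bochner_integral_mult_right continuous) (auto simp: q_def[abs_def] intro!: continuous_intros)
  have eq: "sgn (h x) * (q (exp (- y)) * G y) =
      indicator {0..} y * (exp (- s0 * y) * (q (exp (- y)) * (sgn (h x) * h y)))" for y
    by (simp add: G_def mult_ac)
  have "AE y in lborel. sgn (h x) * (q (exp (- y)) * G y) \<ge> 0"
    unfolding eq
  proof (intro AE_I2)
    fix y
    show "0 \<le> indicator {0..} y * (exp (- s0 * y) * (q (exp (- y)) * (sgn (h x) * h y)))"
      using sign[of y] q_pos[of y] q_zero[of y]
      by (cases "\<bar>y - x\<bar> < d") (auto simp: indicator_def simp del: mult_sgn_abs)
  qed
  then have "AE y in lborel. sgn (h x) * (q (exp (- y)) * G y) = 0"
    by (rule iffD1[OF integral_nonneg_eq_0_iff_AE, rotated])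
      (use int in \<open>simp_all only: has_bochner_integral_iff mult_zero_right\<close>)
  then have "AE y in lborel. y \<notin> {x<..<x + d}"
  proof eventually_elim
    fix y
    assume "sgn (h x) * (q (exp (- y)) * G y) = 0"
    then show "y \<notin> {x<..<x + d}"
      unfolding eq using sign[of y] q_pos[of y] \<open>x \<ge> 0\<close> by (auto simp: indicator_def)
  qed
  then have "{x<..<x + d} \<in> null_sets lborel"
    by (subst AE_iff_null_sets) auto
  then show False
    using d by (simp add: null_sets_def)
qed

lemma laplace_transform_unique:
  fixes f g :: "real \<Rightarrow> real"
  assumes "continuous_on {0..} f" and "continuous_on {0..} g"
    and "\<And>s. s \<ge> s0 \<Longrightarrow> has_laplace_transform f s (L s)"
    and "\<And>s. s \<ge> s0 \<Longrightarrow> has_laplace_transform g s (L s)"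
    and "x \<ge> 0"
  shows "f x = g x"
proof -
  have "f x + (- 1) * g x = 0"
  proof (rule laplace_transform_zero_imp_zero[where h = "\<lambda>x. f x + (- 1) * g x"])
    show "has_laplace_transform (\<lambda>x. f x + (- 1) * g x) s 0" if "s \<ge> s0" for s
      using has_laplace_transform_add[OF assms(3) has_laplace_transform_cmult[OF assms(4), where c = "-1"]]
        that by simp
  qed (use assms in \<open>auto intro!: continuous_intros\<close>)
  then show ?thesis by simp
qed

section \<open>Inverting a shifted rational function of a power\<close>

text \<open>
  Dividing a transform by \<open>s - \<phi>\<close> and shifting it by \<open>\<gamma>\<close> are undone by integration and exponential
  factors, so only the Mittag-Leffler transform itself is left. The constant \<open>C\<close> lets one lemma
  serve both signs of \<open>\<alpha>\<close>: the reciprocal of \<open>K - B (s + \<gamma>)\<^sup>\<alpha>\<close> tends to \<open>0\<close> as \<open>s\<close> grows if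
  \<open>\<alpha> > 0\<close>, but to \<open>1 / K\<close> if \<open>\<alpha> < 0\<close>.
\<close>

lemma laplace_inverse_mittag_leffler:
  fixes W :: "real \<Rightarrow> real"
  assumes a: "a > 0" and \<gamma>: "\<gamma> \<ge> 0" and \<phi>: "\<phi> \<ge> 0"
    and cont: "continuous_on {0..} W"
    and W: "\<And>s. s > \<phi> \<Longrightarrow> has_laplace_transform W s (A s)"
    and A: "\<And>s. s > \<phi> \<Longrightarrow> (s + \<gamma>) powr a \<noteq> \<mu> \<Longrightarrow>
       A s = (C + D / ((s + \<gamma>) powr a - \<mu>)) / (s - \<phi>)"
    and x: "x \<ge> 0"
  shows "W x = exp (\<phi> * x) * (C + D *
     (LINT y:{0..x}|lborel. exp (- (\<gamma> + \<phi>) * y) * y powr (a - 1) * mittag_leffler a a (\<mu> * y powr a)))"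
proof -
  define s0 where "s0 = \<phi> + \<bar>\<mu>\<bar> powr (1 / a) + 1"
  define f where "f y = exp (- (\<gamma> + \<phi>) * y) * y powr (a - 1) * mittag_leffler a a (\<mu> * y powr a)" for y
  define V where "V x = exp (\<phi> * x) * (C + D * (LINT y:{0..x}|lborel. f y))" for x
  have above: "s > \<phi>" "\<bar>\<mu>\<bar> < (s + \<gamma>) powr a" if "s \<ge> s0" for s
  proof -
    show "s > \<phi>"
      using that by (simp add: s0_def) (smt (verit) powr_ge_zero)
    have "(\<bar>\<mu>\<bar> powr (1 / a)) powr a < (s + \<gamma>) powr a"
      using that a \<gamma> \<phi> by (intro powr_less_mono2) (auto simp: s0_def)
    then show "\<bar>\<mu>\<bar> < (s + \<gamma>) powr a"
      using a by (simp add: powr_powr)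
  qed
  have f: "has_laplace_transform f (s - \<phi>) (1 / ((s + \<gamma>) powr a - \<mu>))" if "s \<ge> s0" for s
  proof -
    have "has_laplace_transform (\<lambda>y. y powr (a - 1) * mittag_leffler a a (\<mu> * y powr a))
        (s - \<phi> - - (\<gamma> + \<phi>)) (1 / ((s + \<gamma>) powr a - \<mu>))"
      using has_laplace_transform_mittag_leffler[OF a _ above(2)[OF that]] above(1)[OF that] \<gamma> \<phi> by simp
    from has_laplace_transform_exp_mult[OF this] show ?thesis
      by (simp add: f_def[abs_def] mult.assoc)
  qed
  have cont_V: "continuous_on {0..} V"
    unfolding V_def
    by (intro continuous_intros continuous_on_indefinite_integral[OF f[OF order_refl]])
  have laplace_W: "has_laplace_transform W s (A s)" if "s \<ge> s0" for s
    using W above(1)[OF that] by blast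
  have laplace_V: "has_laplace_transform V s (A s)" if "s \<ge> s0" for s
  proof -
    have s: "s - \<phi> > 0"
      using above(1)[OF that] by simp
    have "has_laplace_transform V s
        (C / (s - \<phi>) + D * (1 / ((s + \<gamma>) powr a - \<mu>) / (s - \<phi>)))"
      unfolding V_def
      by (intro has_laplace_transform_exp_mult has_laplace_transform_add has_laplace_transform_const
          has_laplace_transform_cmult has_laplace_transform_indefinite_integral f s that)
    also have "C / (s - \<phi>) + D * (1 / ((s + \<gamma>) powr a - \<mu>) / (s - \<phi>)) = A s"
      using A[OF above(1)[OF that]] above(2)[OF that] by (auto simp: add_divide_distrib)
    finally show ?thesis .
  qed
  show ?thesis
    using laplace_transform_unique[OF cont cont_V laplace_W laplace_V x] by (simp add: V_def f_def)
qed

section \<open>The scale function of a tempered stable convolution\<close>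

lemma scale_function_has_laplace_transform:
  assumes W: "is_scale_function \<psi> W" and s: "s > Phi_zero \<psi>"
  shows "has_laplace_transform W s (Re (1 / \<psi> (of_real s)))"
proof -
  have "has_bochner_integral lborel
      (\<lambda>x. indicator {0..} x *\<^sub>R (exp (- of_real s * complex_of_real x) * complex_of_real (W x)))
      (1 / \<psi> (of_real s))"
    using W s by (auto simp: is_scale_function_def set_integrable_def set_lebesgue_integral_def
        has_bochner_integral_iff)
  then have "has_bochner_integral lborel
      (\<lambda>x. Re (indicator {0..} x *\<^sub>R (exp (- of_real s * complex_of_real x) * complex_of_real (W x))))
      (Re (1 / \<psi> (of_real s)))"
    by (rule has_bochner_integral_Re)
  also have "(\<lambda>x. Re (indicator {0..} x *\<^sub>R (exp (- of_real s * complex_of_real x) * complex_of_real (W x)))) =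
      (\<lambda>x. indicator {0..} x * (exp (- s * x) * W x))"
    by (simp add: fun_eq_iff Re_exp)
  finally show ?thesis
    by (simp add: has_laplace_transform_def)
qed

lemma Gamma_minus_sign:
  fixes \<alpha> :: real
  assumes "- 1 < \<alpha>" "\<alpha> < 1" "\<alpha> \<noteq> 0"
  shows "\<alpha> * Gamma (- \<alpha>) < 0"
proof -
  have "- \<alpha> \<notin> \<int>\<^sub>\<le>\<^sub>0"
  proof
    assume "- \<alpha> \<in> \<int>\<^sub>\<le>\<^sub>0"
    then obtain n where n: "- \<alpha> = of_int n" "n \<le> 0"
      by (auto elim: nonpos_Ints_cases)
    then have "n = 0"
      using assms(2) by linarith
    then show False
      using n assms(3) by simp
  qed
  then have "- (\<alpha> * Gamma (- \<alpha>)) = Gamma (1 - \<alpha>)"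
    using Gamma_plus1[of "- \<alpha>"] by simp
  also have "\<dots> > 0"
    using assms by (intro Gamma_real_pos) simp
  finally show ?thesis by simp
qed

lemma tsc_exponent_of_real:
  assumes "\<gamma> \<ge> 0" "s \<ge> 0"
  shows "tsc_exponent \<alpha> \<kappa> \<phi> \<gamma> c (of_real s) =
    of_real ((s - \<phi>) * (\<kappa> + c * Gamma (- \<alpha>) * \<gamma> powr \<alpha> - c * Gamma (- \<alpha>) * (s + \<gamma>) powr \<alpha>))"
proof -
  have "(complex_of_real \<gamma> + of_real s) powr complex_of_real \<alpha> = of_real ((s + \<gamma>) powr \<alpha>)"
    using assms powr_of_real[of "s + \<gamma>" \<alpha>] by (simp add: add.commute)
  then show ?thesis
    by (simp add: tsc_exponent_def algebra_simps)
qed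

text \<open>
  The signs of \<open>\<Gamma>(-\<alpha>)\<close> and of the difference \<open>\<gamma>\<^sup>\<alpha> - (s + \<gamma>)\<^sup>\<alpha>\<close> both change with that of \<open>\<alpha>\<close>, so their
  product stays positive. For \<open>\<alpha> < 0\<close> this needs \<open>\<gamma> > 0\<close>, since \<open>0 powr \<alpha> = 0\<close> would spoil
  the monotonicity of the power.
\<close>

lemma tsc_factor_pos:
  fixes \<alpha> \<kappa> \<gamma> c s :: real
  assumes \<alpha>: "- 1 < \<alpha>" "\<alpha> < 1" "\<alpha> \<noteq> 0" and "\<kappa> \<ge> 0" "\<gamma> \<ge> 0" "c > 0"
    and "\<alpha> < 0 \<Longrightarrow> \<gamma> > 0" and s: "s > 0"
  shows "\<kappa> + c * Gamma (- \<alpha>) * \<gamma> powr \<alpha> - c * Gamma (- \<alpha>) * (s + \<gamma>) powr \<alpha> > 0"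
proof -
  have "Gamma (- \<alpha>) * (\<gamma> powr \<alpha> - (s + \<gamma>) powr \<alpha>) > 0"
  proof (cases "\<alpha> > 0")
    case True
    then have "Gamma (- \<alpha>) < 0" "\<gamma> powr \<alpha> < (s + \<gamma>) powr \<alpha>"
      using Gamma_minus_sign[OF \<alpha>] assms by (auto simp: mult_less_0_iff intro!: powr_less_mono2)
    then show ?thesis
      by (intro mult_neg_neg) auto
  next
    case False
    then have "Gamma (- \<alpha>) > 0" "(s + \<gamma>) powr \<alpha> < \<gamma> powr \<alpha>"
      using Gamma_minus_sign[OF \<alpha>] assms by (auto simp: mult_less_0_iff intro!: powr_less_mono2_neg)
    then show ?thesis
      by (intro mult_pos_pos) auto
  qed
  then have "c * (Gamma (- \<alpha>) * (\<gamma> powr \<alpha> - (s + \<gamma>) powr \<alpha>)) > 0"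
    using \<open>c > 0\<close> by simp
  then show ?thesis
    using \<open>\<kappa> \<ge> 0\<close> by (simp add: algebra_simps)
qed

text \<open>
  The exponent has no zero beyond \<open>\<phi>\<close>, and the zero at the origin makes the supremum one over a
  nonempty set, as \<^const>\<open>Sup\<close> on the reals requires.
\<close>

lemma Phi_zero_tsc_le:
  fixes \<alpha> \<kappa> \<phi> \<gamma> c :: real
  assumes "- 1 < \<alpha>" "\<alpha> < 1" "\<alpha> \<noteq> 0" and "\<kappa> \<ge> 0" "\<phi> \<ge> 0" "\<gamma> \<ge> 0" "c > 0"
    and "\<alpha> < 0 \<Longrightarrow> \<gamma> > 0"
    and zero: "\<psi> 0 = 0"
    and tsc: "\<And>\<theta>. Re \<theta> \<ge> 0 \<Longrightarrow> \<psi> \<theta> = tsc_exponent \<alpha> \<kappa> \<phi> \<gamma> c \<theta>"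
  shows "Phi_zero \<psi> \<le> \<phi>"
  unfolding Phi_zero_def
proof (rule cSup_least)
  show "{\<theta>. 0 \<le> \<theta> \<and> \<psi> (complex_of_real \<theta>) = 0} \<noteq> {}"
    using zero by (auto intro: exI[of _ 0])
  fix s
  assume "s \<in> {\<theta>. 0 \<le> \<theta> \<and> \<psi> (complex_of_real \<theta>) = 0}"
  then have s: "s \<ge> 0" "tsc_exponent \<alpha> \<kappa> \<phi> \<gamma> c (complex_of_real s) = 0"
    using tsc[of "of_real s"] by auto
  show "s \<le> \<phi>"
  proof (rule ccontr)
    assume "\<not> s \<le> \<phi>"
    then show False
      using s tsc_factor_pos[of \<alpha> \<kappa> \<gamma> c s] assms
      by (simp add: tsc_exponent_of_real del: of_real_mult of_real_diff of_real_add)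
  qed
qed

theorem theorem6p2:
  fixes M :: "'a measure" and X :: "real \<Rightarrow> 'a \<Rightarrow> real"
    and \<psi> :: "complex \<Rightarrow> complex" and W :: "real \<Rightarrow> real"
    and \<alpha> \<kappa> \<phi> \<gamma> c x :: real
  assumes "- 1 < \<alpha>" and "\<alpha> < 1" and "\<alpha> \<noteq> 0"
    and "\<kappa> \<ge> 0" and "\<phi> \<ge> 0" and "\<gamma> \<ge> 0" and "c > 0"
    and "\<kappa> * \<phi> = 0"
    and "\<alpha> < 0 \<Longrightarrow> \<gamma> > 0"
    and "spectrally_negative_levy_process M X"
    and "is_laplace_exponent M X \<psi>"
    and "\<And>\<theta>. Re \<theta> \<ge> 0 \<Longrightarrow> \<psi> \<theta> = tsc_exponent \<alpha> \<kappa> \<phi> \<gamma> c \<theta>"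
    and "is_scale_function \<psi> W"
    and "x \<ge> 0"
  shows "(0 < \<alpha> \<longrightarrow>
      W x = - (exp (\<phi> * x) / (c * Gamma (- \<alpha>))) *
        (LINT y:{0..x}|lborel. exp (- (\<gamma> + \<phi>) * y) * y powr (\<alpha> - 1) *
          mittag_leffler \<alpha> \<alpha> ((\<kappa> + c * Gamma (- \<alpha>) * \<gamma> powr \<alpha>) * y powr \<alpha> / (c * Gamma (- \<alpha>))))) \<and>
    (\<alpha> < 0 \<longrightarrow>
      W x = exp (\<phi> * x) / (\<kappa> + c * Gamma (- \<alpha>) * \<gamma> powr \<alpha>) +
        c * Gamma (- \<alpha>) * exp (\<phi> * x) / (\<kappa> + c * Gamma (- \<alpha>) * \<gamma> powr \<alpha>)\<^sup>2 *
        (LINT y:{0..x}|lborel. exp (- (\<gamma> + \<phi>) * y) * y powr (- \<alpha> - 1) *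
          mittag_leffler (- \<alpha>) (- \<alpha>)
            (c * Gamma (- \<alpha>) * y powr (- \<alpha>) / (\<kappa> + c * Gamma (- \<alpha>) * \<gamma> powr \<alpha>))))"
proof -
  define B where "B = c * Gamma (- \<alpha>)"
  define K where "K = \<kappa> + B * \<gamma> powr \<alpha>"
  have sign: "\<alpha> * B < 0"
    using Gamma_minus_sign[OF assms(1-3)] \<open>c > 0\<close>
      mult_pos_neg[of c "\<alpha> * Gamma (- \<alpha>)"] by (simp add: B_def mult.left_commute)
  then have "B \<noteq> 0" by auto
  have zero: "\<psi> 0 = 0"
    using assms(11) by (simp add: is_laplace_exponent_def)
  have cont: "continuous_on {0..} W"
    using assms(13) by (simp add: is_scale_function_def)
  have pos: "K - B * (s + \<gamma>) powr \<alpha> > 0" if "s > 0" for s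
    using tsc_factor_pos[OF assms(1-4,6,7,9) that] by (simp add: K_def B_def)
  have W: "has_laplace_transform W s (1 / ((s - \<phi>) * (K - B * (s + \<gamma>) powr \<alpha>)))" if "s > \<phi>" for s
  proof -
    have "Phi_zero \<psi> < s"
      using Phi_zero_tsc_le[OF assms(1-7,9) zero assms(12)] that by linarith
    moreover have "\<psi> (of_real s) = of_real ((s - \<phi>) * (K - B * (s + \<gamma>) powr \<alpha>))"
      using assms(12)[of "of_real s"] tsc_exponent_of_real[of \<gamma> s \<alpha> \<kappa> \<phi> c] that \<open>\<phi> \<ge> 0\<close> \<open>\<gamma> \<ge> 0\<close>
      by (simp add: K_def B_def)
    moreover have "Re (1 / complex_of_real r) = 1 / r" for r
    proof -
      have "1 / complex_of_real r = complex_of_real (1 / r)" by simp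
      then show ?thesis by (simp only: Re_complex_of_real)
    qed
    ultimately show ?thesis
      using scale_function_has_laplace_transform[OF assms(13), of s] by (simp only:)
  qed
  show ?thesis
    unfolding B_def [symmetric] K_def [symmetric]
  proof (intro conjI impI)
    assume "0 < \<alpha>"
    have "W x = exp (\<phi> * x) * (0 + (- 1 / B) * (LINT y:{0..x}|lborel.
        exp (- (\<gamma> + \<phi>) * y) * y powr (\<alpha> - 1) * mittag_leffler \<alpha> \<alpha> (K / B * y powr \<alpha>)))"
    proof (rule laplace_inverse_mittag_leffler[OF \<open>0 < \<alpha>\<close> \<open>\<gamma> \<ge> 0\<close> \<open>\<phi> \<ge> 0\<close> cont W _ \<open>x \<ge> 0\<close>])
      fix s
      assume "\<phi> < s"
      then have "K - B * (s + \<gamma>) powr \<alpha> \<noteq> 0"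
        using pos[of s] \<open>\<phi> \<ge> 0\<close> by simp
      moreover have "K - B * (s + \<gamma>) powr \<alpha> = - B * ((s + \<gamma>) powr \<alpha> - K / B)"
        using \<open>B \<noteq> 0\<close> by (simp add: field_simps)
      ultimately show "1 / ((s - \<phi>) * (K - B * (s + \<gamma>) powr \<alpha>)) =
          (0 + - 1 / B / ((s + \<gamma>) powr \<alpha> - K / B)) / (s - \<phi>)"
        by (simp add: mult.commute)
    qed
    then show "W x = - (exp (\<phi> * x) / B) * (LINT y:{0..x}|lborel.
        exp (- (\<gamma> + \<phi>) * y) * y powr (\<alpha> - 1) * mittag_leffler \<alpha> \<alpha> (K * y powr \<alpha> / B))"
      by simp
  next
    assume "\<alpha> < 0"
    have "\<gamma> > 0" "- \<alpha> > 0"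
      using assms(9) \<open>\<alpha> < 0\<close> by auto
    have "B > 0"
      using sign \<open>\<alpha> < 0\<close> by (simp add: mult_less_0_iff)
    then have "K > 0"
      using \<open>\<kappa> \<ge> 0\<close> \<open>\<gamma> > 0\<close> by (simp add: K_def add_nonneg_pos)
    have "W x = exp (\<phi> * x) * (1 / K + B / K\<^sup>2 * (LINT y:{0..x}|lborel.
        exp (- (\<gamma> + \<phi>) * y) * y powr (- \<alpha> - 1) * mittag_leffler (- \<alpha>) (- \<alpha>) (B / K * y powr (- \<alpha>))))"
    proof (rule laplace_inverse_mittag_leffler[OF \<open>- \<alpha> > 0\<close> \<open>\<gamma> \<ge> 0\<close> \<open>\<phi> \<ge> 0\<close> cont W _ \<open>x \<ge> 0\<close>])
      fix s
      assume "\<phi> < s"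
      define t where "t = (s + \<gamma>) powr (- \<alpha>)"
      have t: "t > 0" "(s + \<gamma>) powr \<alpha> = 1 / t"
        using \<open>\<phi> < s\<close> \<open>\<phi> \<ge> 0\<close> \<open>\<gamma> > 0\<close> by (auto simp: t_def powr_minus field_simps)
      have "K - B / t > 0"
        using pos[of s] t \<open>\<phi> < s\<close> \<open>\<phi> \<ge> 0\<close> by simp
      then have "K * t - B > 0"
        using t by (simp add: field_simps)
      have "1 / ((s - \<phi>) * (K - B * (s + \<gamma>) powr \<alpha>)) = 1 / (K - B / t) / (s - \<phi>)"
        by (simp add: t(2) mult.commute)
      \<comment> \<open>Multiplying numerator and denominator by \<open>t = (s + \<gamma>)\<^bsup>-\<alpha>\<^esup>\<close> turns the
        negative power into the positive one and splits off the constant \<open>1 / K\<close>.\<close>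
      also have "1 / (K - B / t) = 1 / K + B / K\<^sup>2 / (t - B / K)"
        using \<open>K > 0\<close> \<open>K * t - B > 0\<close> t(1) by (simp add: field_simps power2_eq_square)
      finally show "1 / ((s - \<phi>) * (K - B * (s + \<gamma>) powr \<alpha>)) =
          (1 / K + B / K\<^sup>2 / ((s + \<gamma>) powr (- \<alpha>) - B / K)) / (s - \<phi>)"
        by (simp only: t_def)
    qed
    then show "W x = exp (\<phi> * x) / K + B * exp (\<phi> * x) / K\<^sup>2 * (LINT y:{0..x}|lborel.
        exp (- (\<gamma> + \<phi>) * y) * y powr (- \<alpha> - 1) * mittag_leffler (- \<alpha>) (- \<alpha>) (B * y powr (- \<alpha>) / K))"
      by (simp add: algebra_simps)
  qed
qed

end
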